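(* Let $G=(V,E)$ be a bipartite graph, and let $P_G\subseteq\mathbb{R}^E$ be its perfect matching polytope, described by the constraints $\sum_{e\ni v}x_e=1$ for all $v\in V$ and $x_e\ge 0$ for all $e\in E$. Then: 1. A non-zero vector $\mathbf{g}\in\mathbb{R}^E$ is a circuit for $P_G$ (with respect to this description) if and only if there exist an even cycle $C$ in $G$, decomposed into matchings $C^+,C^-\subseteq C$ (alternately appearing along $C$), and $\alpha>0$ such that $\mathbf{g}=\mathbf{g}(C,\alpha)$, where $$\mathbf{g}(C,\alpha)_e:=\begin{cases}\alpha, & \text{if } e\in C^+,\\ -\alpha, & \text{if } e\in C^-,\\ 0, & \text{if } e\notin C.\end{cases}$$ 2. If $\mathbf{x}$ is a vertex of $P_G$, and $\mathbf{x}'\ne\mathbf{x}$ is obtained from $\mathbf{x}$ by a circuit move, then $\mathbf{x}'$ is also a vertex of $P_G$ and is adjacent to $\mathbf{x}$ on the skeleton of $P_G$.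
   Context: The perfect matching polytope $P_G$ of a bipartite graph $G=(V,E)$ is the convex hull in $\mathbb{R}^E$ of the 0/1 incidence vectors of the perfect matchings of $G$; for bipartite $G$ it equals the set of $\mathbf{x}\in\mathbb{R}^E$ satisfying the constraints given in the claim. The skeleton of $P_G$ is the graph formed by its vertices and edges. Cycles are identified with their edge sets. Circuits: given a polyhedron $\mathcal{P}=\{\mathbf{x}\in\mathbb{R}^n \mid A\mathbf{x}=\mathbf{b},\ B\mathbf{x}\le\mathbf{d}\}$, a circuit is a vector $\mathbf{g}\in\mathbb{R}^n\setminus\{\mathbf{0}\}$ such that (1) $A\mathbf{g}=\mathbf{0}$, and (2) the support of $B\mathbf{g}$ is inclusion-wise minimal among the supports of the members of the collection $\{B\mathbf{y}\mid A\mathbf{y}=\mathbf{0},\ \mathbf{y}\ne\mathbf{0}\}$. For $P_G$, $A$ is the vertex-edge incidence matrix of $G$, $\mathbf{b}=\mathbf{1}$, $B=-I$, and $\mathbf{d}=\mathbf{0}$. Circuit moves: given a linear program $\max\{\mathbf{c}^T\mathbf{x}\mid\mathbf{x}\in\mathcal{P}\}$, a current feasible solution $\mathbf{x}\in\mathcal{P}$ and a circuit $\mathbf{g}$ with $\mathbf{c}^T\mathbf{g}>0$, a circuit move consists of moving to the new feasible solution $\mathbf{x}'=\mathbf{x}+t^\ast\mathbf{g}$, where $t^\ast\ge 0$ is maximal with respect to $\mathbf{x}+t^\ast\mathbf{g}\in\mathcal{P}$. *)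

theory Defs
  imports "HOL-Analysis.Analysis"
begin

section \<open>Polyhedra, circuits and circuit moves\<close>

text \<open>
  The space \<open>\<real>\<^sup>I\<close> for a subset \<open>I\<close> of a finite index type is represented by the vectors vanishing
  outside \<open>I\<close>.  Working in this coordinate subspace allows arbitrary (also empty) index sets
  while keeping the ambient Euclidean space of the library's polytope theory.
\<close>

definition coord_space :: "'n set \<Rightarrow> (real ^ 'n) set" where
  "coord_space I = {x. \<forall>i. i \<notin> I \<longrightarrow> x $ i = 0}"

definition vec_support :: "real ^ 'n \<Rightarrow> 'n set" where
  "vec_support x = {i. x $ i \<noteq> 0}"

definition polyhedron_of ::
  "'n set \<Rightarrow> real ^ 'n ^ 'm \<Rightarrow> real ^ 'm \<Rightarrow> real ^ 'n ^ 'k \<Rightarrow> real ^ 'k \<Rightarrow> (real ^ 'n) set" where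
  "polyhedron_of I A b B d = {x \<in> coord_space I. A *v x = b \<and> B *v x \<le> d}"

definition is_circuit :: "'n set \<Rightarrow> real ^ 'n ^ 'm \<Rightarrow> real ^ 'n ^ 'k \<Rightarrow> real ^ 'n \<Rightarrow> bool" where
  "is_circuit I A B g \<longleftrightarrow>
     g \<in> coord_space I \<and> g \<noteq> 0 \<and> A *v g = 0 \<and>
     \<not> (\<exists>y \<in> coord_space I. y \<noteq> 0 \<and> A *v y = 0 \<and> vec_support (B *v y) \<subset> vec_support (B *v g))"

definition circuit_move ::
  "'n set \<Rightarrow> real ^ 'n ^ 'm \<Rightarrow> real ^ 'm \<Rightarrow> real ^ 'n ^ 'k \<Rightarrow> real ^ 'k
    \<Rightarrow> real ^ 'n \<Rightarrow> real ^ 'n \<Rightarrow> real ^ 'n \<Rightarrow> bool" where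
  "circuit_move I A b B d c x x' \<longleftrightarrow>
     x \<in> polyhedron_of I A b B d \<and>
     (\<exists>g t. is_circuit I A B g \<and> c \<bullet> g > 0 \<and>
        t \<ge> 0 \<and> x + t *\<^sub>R g \<in> polyhedron_of I A b B d \<and>
        (\<forall>s \<ge> 0. x + s *\<^sub>R g \<in> polyhedron_of I A b B d \<longrightarrow> s \<le> t) \<and>
        x' = x + t *\<^sub>R g)"

definition skeleton_adjacent :: "('a::euclidean_space) set \<Rightarrow> 'a \<Rightarrow> 'a \<Rightarrow> bool" where
  "skeleton_adjacent P x y \<longleftrightarrow>
     x extreme_point_of P \<and> y extreme_point_of P \<and> x \<noteq> y \<and> closed_segment x y edge_of P"

section \<open>Bipartite graphs, matchings and cycles\<close>

definition simple_graph :: "'v::finite set \<Rightarrow> 'v set set \<Rightarrow> bool" where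
  "simple_graph V E \<longleftrightarrow> (\<forall>e \<in> E. e \<subseteq> V \<and> card e = 2)"

definition bipartite_graph :: "'v::finite set \<Rightarrow> 'v set set \<Rightarrow> bool" where
  "bipartite_graph V E \<longleftrightarrow>
     simple_graph V E \<and>
     (\<exists>X Y. X \<union> Y = V \<and> X \<inter> Y = {} \<and> (\<forall>e \<in> E. \<exists>x \<in> X. \<exists>y \<in> Y. e = {x, y}))"

definition matching :: "'v set set \<Rightarrow> 'v set set \<Rightarrow> bool" where
  "matching E M \<longleftrightarrow> M \<subseteq> E \<and> pairwise disjnt M"

definition perfect_matching :: "'v set \<Rightarrow> 'v set set \<Rightarrow> 'v set set \<Rightarrow> bool" where
  "perfect_matching V E M \<longleftrightarrow> matching E M \<and> \<Union>M = V"

text \<open>A cycle is traversed by the list of its pairwise distinct vertices; the last vertex is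
  joined back to the first one.\<close>

definition cycle_edge :: "'v list \<Rightarrow> nat \<Rightarrow> 'v set" where
  "cycle_edge vs i = {vs ! i, vs ! (Suc i mod length vs)}"

definition cycle_traversal :: "'v set set \<Rightarrow> 'v list \<Rightarrow> 'v set set \<Rightarrow> bool" where
  "cycle_traversal E vs C \<longleftrightarrow>
     length vs \<ge> 3 \<and> distinct vs \<and> C = cycle_edge vs ` {..<length vs} \<and> C \<subseteq> E"

definition even_cycle_decomposition ::
  "'v set set \<Rightarrow> 'v set set \<Rightarrow> 'v set set \<Rightarrow> 'v set set \<Rightarrow> bool" where
  "even_cycle_decomposition E C Cp Cm \<longleftrightarrow>
     even (card C) \<and> matching E Cp \<and> matching E Cm \<and> Cp \<union> Cm = C \<and> Cp \<inter> Cm = {} \<and>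
     (\<exists>vs. cycle_traversal E vs C \<and>
        (\<forall>i < length vs. cycle_edge vs i \<in> Cp \<longleftrightarrow> cycle_edge vs (Suc i mod length vs) \<in> Cm))"

definition cycle_vector :: "'v::finite set set \<Rightarrow> 'v set set \<Rightarrow> real \<Rightarrow> real ^ 'v set" where
  "cycle_vector Cp Cm \<alpha> = (\<chi> e. if e \<in> Cp then \<alpha> else if e \<in> Cm then - \<alpha> else 0)"

section \<open>The perfect matching polytope\<close>

definition incidence_vector :: "'v::finite set set \<Rightarrow> real ^ 'v set" where
  "incidence_vector M = (\<chi> e. if e \<in> M then 1 else 0)"

definition perfect_matching_polytope :: "'v::finite set \<Rightarrow> 'v set set \<Rightarrow> (real ^ 'v set) set" where
  "perfect_matching_polytope V E = convex hull (incidence_vector ` {M. perfect_matching V E M})"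

text \<open>The description \<open>A x = b\<close>, \<open>B x \<le> d\<close> with \<open>B = - I\<close> and \<open>d = 0\<close>.  Rows belonging to elements
  outside \<open>V\<close> (for \<open>A\<close> and \<open>b\<close>) or outside \<open>E\<close> (for \<open>B\<close> and \<open>d\<close>) are trivial on \<open>\<real>\<^sup>E\<close>.\<close>

definition pm_A :: "'v::finite set \<Rightarrow> 'v set set \<Rightarrow> real ^ ('v set) ^ 'v" where
  "pm_A V E = (\<chi> v e. if v \<in> V \<and> e \<in> E \<and> v \<in> e then 1 else 0)"

definition pm_b :: "'v::finite set \<Rightarrow> real ^ 'v" where
  "pm_b V = (\<chi> v. if v \<in> V then 1 else 0)"

definition pm_B :: "real ^ ('v::finite set) ^ ('v set)" where
  "pm_B = - mat 1"

definition pm_d :: "real ^ ('v::finite set)" where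
  "pm_d = 0"

text \<open>For bipartite graphs the convex hull of the perfect matchings is the polyhedron given by
  this description.\<close>

lemma pm_A_nth: "(pm_A V E *v x) $ v = (if v \<in> V then \<Sum>e \<in> {e \<in> E. v \<in> e}. x $ e else 0)"
proof -
  have "(pm_A V E *v x) $ v = (\<Sum>e\<in>UNIV. if v \<in> V \<and> e \<in> E \<and> v \<in> e then x $ e else 0)"
    unfolding matrix_vector_mult_def pm_A_def by (auto intro: sum.cong)
  then show ?thesis
    by (simp add: sum.If_cases Int_def)
qed

lemma mem_pm_polyhedron:
  "x \<in> polyhedron_of E (pm_A V E) (pm_b V) pm_B pm_d \<longleftrightarrow>
     (\<forall>e. e \<notin> E \<longrightarrow> x $ e = 0) \<and> (\<forall>v \<in> V. (\<Sum>e \<in> {e \<in> E. v \<in> e}. x $ e) = 1) \<and> (\<forall>e \<in> E. x $ e \<ge> 0)"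
proof -
  have m: "pm_B *v x = - x"
    unfolding pm_B_def using matrix_vector_mult_diff_rdistrib[of 0 "mat 1" x] by simp
  have B: "pm_B *v x \<le> pm_d \<longleftrightarrow> (\<forall>e. x $ e \<ge> 0)"
    unfolding m pm_d_def by (simp add: less_eq_vec_def)
  have A: "pm_A V E *v x = pm_b V \<longleftrightarrow> (\<forall>v \<in> V. (\<Sum>e \<in> {e \<in> E. v \<in> e}. x $ e) = 1)"
    by (auto simp: vec_eq_iff pm_A_nth pm_b_def)
  show ?thesis
    unfolding polyhedron_of_def coord_space_def mem_Collect_eq A B
    by (metis order_refl)
qed

lemma kernel_vector_if_min_degree_two:
  fixes V :: "'v::finite set"
  assumes G: "bipartite_graph V E" and F: "F \<subseteq> E" "F \<noteq> {}"
    and deg: "\<And>v. v \<in> \<Union>F \<Longrightarrow> card {e \<in> F. v \<in> e} \<ge> 2"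
  obtains y where "y \<in> coord_space F" "y \<noteq> 0" "pm_A V E *v y = 0"
proof -
  obtain X Y where XY: "X \<union> Y = V" "X \<inter> Y = {}" "\<forall>e \<in> E. \<exists>x \<in> X. \<exists>y \<in> Y. e = {x, y}"
    using G unfolding bipartite_graph_def by blast
  have c2: "card e = 2" "e \<subseteq> V" if "e \<in> E" for e
    using G that unfolding bipartite_graph_def simple_graph_def by auto
  define W where "W = \<Union>F"
  have WV: "W \<subseteq> V" using c2 F(1) unfolding W_def by auto
  let ?A = "pm_A V E"
  let ?f = "\<lambda>y. ?A *v y"
  have "2 * card W \<le> (\<Sum>v\<in>W. card {e \<in> F. v \<in> e})"
    using sum_mono[of W "\<lambda>_. 2" "\<lambda>v. card {e \<in> F. v \<in> e}"] deg unfolding W_def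
    by (simp add: mult.commute)
  also have "\<dots> = (\<Sum>v\<in>W. \<Sum>e\<in>F. if v \<in> e then 1 else 0)"
    by (simp add: sum.If_cases Int_def)
  also have "\<dots> = (\<Sum>e\<in>F. \<Sum>v\<in>W. if v \<in> e then 1 else 0)"
    by (rule sum.swap)
  also have "\<dots> = (\<Sum>e\<in>F. card e)"
  proof (rule sum.cong[OF refl])
    fix e assume "e \<in> F"
    then have "W \<inter> e = e" unfolding W_def by auto
    then show "(\<Sum>v\<in>W. if v \<in> e then 1 else 0) = card e"
      by (simp add: sum.If_cases)
  qed
  also have "\<dots> = 2 * card F"
    using c2 F(1) by (subst sum.cong[OF refl, where h = "\<lambda>_. 2"]) auto
  finally have WF: "card W \<le> card F" by simp
  let ?Z = "{z :: real ^ 'v. \<forall>v. v \<notin> W \<longrightarrow> z $ v = 0}"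
  let ?T = "coord_space F"
  have dZ: "dim ?Z = card W"
    using dim_substandard_cart[where 'a = real, of W] by (simp add: dim_vec_eq)
  have dT: "dim ?T = card F"
    using dim_substandard_cart[where 'a = real, of F] by (simp add: dim_vec_eq coord_space_def)
  have sT: "subspace ?T" unfolding coord_space_def subspace_def by auto
  have sZ: "subspace ?Z" unfolding subspace_def by auto
  have sf: "subspace (?f ` ?T)"
    by (rule linear_subspace_image[OF matrix_vector_mul_linear sT])
  have y0: "y $ e = 0" if "y \<in> ?T" "e \<notin> F" for y e
    using that unfolding coord_space_def by auto
  have fZ: "?f ` ?T \<subseteq> ?Z"
  proof clarsimp
    fix y v assume y: "y \<in> ?T" and v: "v \<notin> W"
    have "y $ e = 0" if "v \<in> e" for e
      using y0[OF y, of e] v that unfolding W_def by auto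
    then show "(?A *v y) $ v = 0" by (simp add: pm_A_nth)
  qed
  have side: "(\<Sum>v\<in>S. (?A *v y) $ v) = (\<Sum>e\<in>E. y $ e)"
    if S: "S \<subseteq> V" "\<And>e. e \<in> E \<Longrightarrow> \<exists>v. S \<inter> e = {v}" for S y
  proof -
    have "(\<Sum>v\<in>S. (?A *v y) $ v) = (\<Sum>v\<in>S. \<Sum>e\<in>E. if v \<in> e then y $ e else 0)"
      using S(1) by (intro sum.cong) (auto simp: pm_A_nth sum.If_cases Int_def)
    also have "\<dots> = (\<Sum>e\<in>E. \<Sum>v\<in>S. if v \<in> e then y $ e else 0)"
      by (rule sum.swap)
    also have "\<dots> = (\<Sum>e\<in>E. y $ e)"
    proof (rule sum.cong[OF refl])
      fix e assume "e \<in> E"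
      then obtain v where "S \<inter> e = {v}" using S(2) by blast
      then show "(\<Sum>v\<in>S. if v \<in> e then y $ e else 0) = y $ e"
        by (simp add: sum.If_cases)
    qed
    finally show ?thesis .
  qed
  have bal: "(\<Sum>v\<in>X. (?A *v y) $ v) = (\<Sum>v\<in>Y. (?A *v y) $ v)" for y
  proof -
    have "\<exists>v. X \<inter> e = {v}" "\<exists>v. Y \<inter> e = {v}" if e: "e \<in> E" for e
    proof -
      obtain a b where "a \<in> X" "b \<in> Y" "e = {a, b}" using bspec[OF XY(3) e] by metis
      then have "X \<inter> e = {a}" "Y \<inter> e = {b}" using XY(2) by auto
      then show "\<exists>v. X \<inter> e = {v}" "\<exists>v. Y \<inter> e = {v}" by auto
    qed
    then show ?thesis using side[of X y] side[of Y y] XY(1) by auto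
  qed
  obtain w where w: "w \<in> W"
  proof -
    obtain e where "e \<in> F" using F(2) by blast
    moreover from this have "e \<noteq> {}" using c2(1) F(1) by force
    ultimately show ?thesis using that unfolding W_def by blast
  qed
  have "axis w 1 \<notin> ?f ` ?T"
  proof
    assume "axis w 1 \<in> ?f ` ?T"
    then have "(\<Sum>v\<in>X. axis w (1::real) $ v) = (\<Sum>v\<in>Y. axis w 1 $ v)"
      using bal by auto
    moreover have "(\<Sum>v\<in>S. axis w (1::real) $ v) = (if w \<in> S then 1 else 0)" for S
      by (simp add: axis_def)
    ultimately show False using w WV XY(1,2) by (auto split: if_splits)
  qed
  moreover have "axis w 1 \<in> ?Z" using w by (auto simp: axis_def)
  ultimately have "?f ` ?T \<noteq> ?Z" by blast
  then have "dim (?f ` ?T) < dim ?Z"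
    using subspace_dim_equal[OF sf sZ fZ] by linarith
  then have "dim (?f ` ?T) < dim ?T" using dZ dT WF by linarith
  then have "\<not> inj_on ?f (span ?T)"
    using dim_image_eq[OF matrix_vector_mul_linear, of ?A ?T] by auto
  then have "\<not> inj_on ?f ?T" using span_eq_iff sT by metis
  then obtain a b where ab: "a \<in> ?T" "b \<in> ?T" "a \<noteq> b" "?A *v a = ?A *v b"
    unfolding inj_on_def by blast
  show ?thesis
  proof (rule that[of "a - b"])
    show "a - b \<in> ?T" using ab sT subspace_diff by blast
    show "a - b \<noteq> 0" using ab by auto
    show "?A *v (a - b) = 0" using ab by (simp add: matrix_vector_mult_diff_distrib)
  qed
qed

theorem perfect_matching_polytope_eq_polyhedron:
  fixes V :: "'v::finite set"
  assumes G: "bipartite_graph V E"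
  shows "perfect_matching_polytope V E = polyhedron_of E (pm_A V E) (pm_b V) pm_B pm_d"
    (is "_ = ?P")
proof
  have c2: "card e = 2" "e \<subseteq> V" if "e \<in> E" for e
    using G that unfolding bipartite_graph_def simple_graph_def by auto
  have cvx: "convex ?P"
  proof (rule convexI)
    fix x y :: "real ^ 'v set" and u v :: real
    assume "x \<in> ?P" "y \<in> ?P" "0 \<le> u" "0 \<le> v" "u + v = 1"
    then show "u *\<^sub>R x + v *\<^sub>R y \<in> ?P"
      by (simp add: mem_pm_polyhedron sum.distrib flip: sum_distrib_left)
  qed
  have "incidence_vector M \<in> ?P" if M: "perfect_matching V E M" for M
  proof -
    have M': "M \<subseteq> E" "pairwise disjnt M" "\<Union>M = V"
      using M unfolding perfect_matching_def matching_def by auto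
    have "(\<Sum>e \<in> {e \<in> E. v \<in> e}. incidence_vector M $ e) = 1" if "v \<in> V" for v
    proof -
      obtain m where m: "m \<in> M" "v \<in> m" using M'(3) \<open>v \<in> V\<close> by blast
      have "{e \<in> E. v \<in> e} \<inter> M = {m}"
        using M' m unfolding pairwise_def disjnt_def by blast
      then show ?thesis by (simp add: incidence_vector_def sum.If_cases)
    qed
    then show ?thesis using M'(1) by (auto simp: mem_pm_polyhedron incidence_vector_def)
  qed
  then show "perfect_matching_polytope V E \<subseteq> ?P"
    unfolding perfect_matching_polytope_def by (intro hull_minimal) (auto simp: cvx)
  have nn: "x $ e \<ge> 0" if "x \<in> ?P" for x e
    using that unfolding mem_pm_polyhedron by (cases "e \<in> E") auto
  have le1: "x $ e \<le> 1" if x: "x \<in> ?P" for x e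
  proof (cases "e \<in> E")
    case True
    then obtain v where v: "v \<in> e" "v \<in> V" using c2[of e] by (metis card_2_iff' subsetD)
    have "x $ e \<le> (\<Sum>e \<in> {e \<in> E. v \<in> e}. x $ e)"
      using True v nn[OF x] by (intro member_le_sum) auto
    then show ?thesis using x v unfolding mem_pm_polyhedron by auto
  next
    case False
    then show ?thesis using x unfolding mem_pm_polyhedron by auto
  qed
  have "bounded ?P"
  proof (rule bounded_subset[OF bounded_cbox])
    show "?P \<subseteq> cbox 0 (\<chi> e. 1)" using nn le1 by (auto simp: mem_box_cart)
  qed
  moreover have "closed ?P"
  proof -
    have eq: "?P = (\<Inter>e\<in>-E. {x. x $ e = 0}) \<inter> (\<Inter>v\<in>V. {x. (\<Sum>e \<in> {e \<in> E. v \<in> e}. x $ e) = 1})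
        \<inter> (\<Inter>e\<in>E. {x. x $ e \<ge> 0})"
      by (auto simp: mem_pm_polyhedron)
    show ?thesis unfolding eq
      by (intro closed_Int closed_INT ballI closed_Collect_eq closed_Collect_le continuous_intros)
  qed
  ultimately have cmp: "compact ?P" by (simp add: compact_eq_bounded_closed)
  have ext: "x \<in> incidence_vector ` {M. perfect_matching V E M}" if x: "x extreme_point_of ?P" for x
  proof -
    have xP: "x \<in> ?P" using x unfolding extreme_point_of_def by auto
    have xsum: "(\<Sum>e \<in> {e \<in> E. v \<in> e}. x $ e) = 1" if "v \<in> V" for v
      using xP that unfolding mem_pm_polyhedron by auto
    define F where "F = {e \<in> E. x $ e \<noteq> 0 \<and> x $ e \<noteq> 1}"
    have "F = {}"
    proof (rule ccontr)
      assume Fne: "F \<noteq> {}"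
      have deg: "card {e \<in> F. v \<in> e} \<ge> 2" if v: "v \<in> \<Union>F" for v
      proof (rule ccontr)
        assume "\<not> card {e \<in> F. v \<in> e} \<ge> 2"
        moreover obtain f where f: "f \<in> F" "v \<in> f" using v by blast
        moreover have "card {e \<in> F. v \<in> e} \<noteq> 0" using f by auto
        ultimately have "card {e \<in> F. v \<in> e} = 1" by linarith
        then obtain h where "{e \<in> F. v \<in> e} = {h}" using card_1_singletonE by metis
        moreover from this have "f = h" using f by (metis (no_types, lifting) mem_Collect_eq singletonD)
        ultimately have Ff: "{e \<in> F. v \<in> e} = {f}" by simp
        have fE: "f \<in> E" "v \<in> V" using f c2(2)[of f] unfolding F_def by blast+
        have "(\<Sum>e \<in> {e \<in> E. v \<in> e}. x $ e) = x $ f + (\<Sum>e \<in> {e \<in> E. v \<in> e} - {f}. x $ e)"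
          using fE f by (subst sum.remove[of _ f]) auto
        then have s: "x $ f + (\<Sum>e \<in> {e \<in> E. v \<in> e} - {f}. x $ e) = 1" using xsum fE by simp
        have "x $ e \<in> \<int>" if "e \<in> {e \<in> E. v \<in> e} - {f}" for e
        proof -
          have "e \<notin> F" using that Ff by blast
          then have "x $ e = 0 \<or> x $ e = 1" using that unfolding F_def by blast
          then show ?thesis by auto
        qed
        then have "(\<Sum>e \<in> {e \<in> E. v \<in> e} - {f}. x $ e) \<in> \<int>" by (intro Ints_sum) blast
        then have "x $ f \<in> \<int>" using s by (metis Ints_1 Ints_diff add_diff_cancel_right')
        then obtain k where k: "x $ f = of_int k" by (auto elim: Ints_cases)
        have "x $ f > 0" "x $ f < 1"
          using nn[OF xP, of f] le1[OF xP, of f] f unfolding F_def by auto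
        then show False unfolding k by simp
      qed
      have "F \<subseteq> E" unfolding F_def by auto
      from kernel_vector_if_min_degree_two[OF G this Fne deg]
      obtain y where y: "y \<in> coord_space F" "y \<noteq> 0" "pm_A V E *v y = 0" by blast
      have ysum: "(\<Sum>e \<in> {e \<in> E. v \<in> e}. y $ e) = 0" if "v \<in> V" for v
        using y(3) that pm_A_nth[of V E y v] by simp
      have y0: "y $ e = 0" if "e \<notin> F" for e using y(1) that unfolding coord_space_def by auto
      define m where "m = Min ((\<lambda>e. x $ e) ` F)"
      have "m \<in> (\<lambda>e. x $ e) ` F" unfolding m_def by (rule Min_in) (use Fne in auto)
      then have mpos: "m > 0" using nn[OF xP] unfolding F_def by (auto simp: less_le)
      have mle: "m \<le> x $ e" if "e \<in> F" for e unfolding m_def using that by auto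
      define \<epsilon> where "\<epsilon> = m / (1 + norm y)"
      have npos: "1 + norm y > 0" by (simp add: add_pos_nonneg)
      have epos: "\<epsilon> > 0" unfolding \<epsilon>_def using mpos npos by simp
      have eb: "\<epsilon> * \<bar>y $ e\<bar> \<le> x $ e" for e
      proof (cases "e \<in> F")
        case True
        have "\<epsilon> * \<bar>y $ e\<bar> \<le> \<epsilon> * (1 + norm y)"
          using epos component_le_norm_cart[of y e] by (intro mult_left_mono) auto
        also have "\<dots> = m" unfolding \<epsilon>_def using npos by simp
        finally show ?thesis using mle[OF True] by simp
      next
        case False
        then show ?thesis using y0 nn[OF xP] by simp
      qed
      have mem: "x + s *\<^sub>R y \<in> ?P" if s: "\<bar>s\<bar> = \<epsilon>" for s
      proof -
        have "x $ e + s * y $ e \<ge> 0" for e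
        proof -
          have "\<bar>s * y $ e\<bar> \<le> x $ e" using eb[of e] s by (simp add: abs_mult)
          then show ?thesis by linarith
        qed
        moreover have "x $ e = 0" "y $ e = 0" if "e \<notin> E" for e
          using that xP y0[of e] unfolding mem_pm_polyhedron F_def by auto
        ultimately show ?thesis
          by (simp add: mem_pm_polyhedron sum.distrib xsum ysum flip: sum_distrib_left)
      qed
      have "x + \<epsilon> *\<^sub>R y \<in> ?P" "x + (- \<epsilon>) *\<^sub>R y \<in> ?P" using mem[of "\<epsilon>"] mem[of "- \<epsilon>"] epos by simp_all
      moreover have "x \<in> open_segment (x + \<epsilon> *\<^sub>R y) (x + (- \<epsilon>) *\<^sub>R y)"
      proof -
        have "midpoint (x + \<epsilon> *\<^sub>R y) (x + (- \<epsilon>) *\<^sub>R y) = x"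
          by (simp add: midpoint_def flip: scaleR_2)
        moreover have "x + \<epsilon> *\<^sub>R y \<noteq> x + (- \<epsilon>) *\<^sub>R y"
        proof
          assume "x + \<epsilon> *\<^sub>R y = x + (- \<epsilon>) *\<^sub>R y"
          then have "(2 * \<epsilon>) *\<^sub>R y = 0" by (simp add: algebra_simps flip: scaleR_2)
          then show False using epos y(2) by simp
        qed
        ultimately show ?thesis by (metis midpoint_in_open_segment)
      qed
      ultimately show False using x unfolding extreme_point_of_def by blast
    qed
    then have x01: "x $ e = 0 \<or> x $ e = 1" if "e \<in> E" for e using that unfolding F_def by auto
    define M where "M = {e \<in> E. x $ e = 1}"
    have xM: "x = incidence_vector M"
      using x01 xP by (auto simp: vec_eq_iff incidence_vector_def M_def mem_pm_polyhedron)
    have cM: "card {e \<in> M. v \<in> e} = 1" if "v \<in> V" for v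
    proof -
      have "{e \<in> E. v \<in> e} \<inter> M = {e \<in> M. v \<in> e}" unfolding M_def by auto
      then have "real (card {e \<in> M. v \<in> e}) = (\<Sum>e \<in> {e \<in> E. v \<in> e}. x $ e)"
        unfolding xM by (simp add: incidence_vector_def sum.If_cases)
      then show ?thesis using xsum[OF that] by simp
    qed
    have "M \<subseteq> E" unfolding M_def by auto
    moreover have "pairwise disjnt M"
    proof (rule pairwiseI, rule ccontr)
      fix e f assume ef: "e \<in> M" "f \<in> M" "e \<noteq> f" "\<not> disjnt e f"
      then obtain v where v: "v \<in> e" "v \<in> f" unfolding disjnt_def by blast
      then have "v \<in> V" using c2(2)[of e] ef \<open>M \<subseteq> E\<close> by blast
      then obtain h where h: "{e \<in> M. v \<in> e} = {h}" using cM card_1_singletonE by metis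
      have "e \<in> {e \<in> M. v \<in> e}" "f \<in> {e \<in> M. v \<in> e}" using ef v by simp_all
      then show False using ef(3) unfolding h by simp
    qed
    moreover have "\<Union>M = V"
    proof
      show "\<Union>M \<subseteq> V" using c2(2) \<open>M \<subseteq> E\<close> by blast
      show "V \<subseteq> \<Union>M"
      proof
        fix v assume "v \<in> V"
        then have "{e \<in> M. v \<in> e} \<noteq> {}" using cM by (metis card.empty zero_neq_one)
        then show "v \<in> \<Union>M" by blast
      qed
    qed
    ultimately show ?thesis using xM unfolding perfect_matching_def matching_def by blast
  qed
  have "?P = convex hull {x. x extreme_point_of ?P}" by (rule Krein_Milman_Minkowski[OF cmp cvx])
  also have "\<dots> \<subseteq> perfect_matching_polytope V E"
    unfolding perfect_matching_polytope_def by (rule hull_mono) (use ext in blast)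
  finally show "?P \<subseteq> perfect_matching_polytope V E" .
qed

end

theory Submission
  imports Defs
begin

text \<open>
  By support minimality, every kernel vector supported in the support of a circuit is a multiple of
  that circuit. The support of a circuit has minimum degree two, so it contains a cycle, which is
  even because the graph is bipartite; the alternating vector of that cycle lies in the kernel, so
  the circuit is a multiple of it. Conversely, at every vertex of a cycle a kernel vector supported
  on the cycle changes sign, so it vanishes as soon as one of its entries on the cycle does.

  For a move from \<open>x\<close> to \<open>x'\<close>, consider the face of all points that vanish wherever \<open>x\<close> and \<open>x'\<close>
  both vanish. Since \<open>x\<close> is a perfect matching, the difference of such a point and \<open>x\<close> is supported
  in the support of the circuit, hence is a multiple of it. The face is therefore the segment from
  \<open>x\<close> to \<open>x'\<close>.
\<close>

section \<open>Kernel vectors and circuits\<close>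

lemma simple_graph_edge:
  assumes "bipartite_graph V E" "e \<in> E"
  shows "card e = 2" "e \<subseteq> V"
  using assms unfolding bipartite_graph_def simple_graph_def by auto

lemma pm_A_kernel_iff:
  "pm_A V E *v g = 0 \<longleftrightarrow> (\<forall>v\<in>V. (\<Sum>e \<in> {e \<in> E. v \<in> e}. g $ e) = 0)"
  by (auto simp: vec_eq_iff pm_A_nth)

text \<open>As \<open>pm_B\<close> is the negated identity, the minimality in
  \<open>is_circuit\<close> concerns the support of the vector itself.\<close>

lemma vec_support_pm_B: "vec_support (pm_B *v y) = vec_support y"
proof -
  have "pm_B *v y = - y"
    unfolding pm_B_def using matrix_vector_mult_diff_rdistrib[of 0 "mat 1" y] by simp
  then show ?thesis by (simp add: vec_support_def)
qed

text \<open>Otherwise all products \<open>h b * h a\<close> are nonnegative with sum zero, so even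
  \<open>h a * h a\<close> would vanish.\<close>

lemma sum_eq_0_opposite_sign:
  fixes h :: "'a \<Rightarrow> real"
  assumes "finite S" "sum h S = 0" "a \<in> S" "h a \<noteq> 0"
  obtains b where "b \<in> S" "h b * h a < 0"
proof -
  have "\<exists>b\<in>S. h b * h a < 0"
  proof (rule ccontr)
    assume "\<not> ?thesis"
    then have nn: "\<And>b. b \<in> S \<Longrightarrow> 0 \<le> h b * h a" by force
    have "(\<Sum>b\<in>S. h b * h a) = 0"
      using assms(2) by (simp flip: sum_distrib_right)
    then have "h a * h a = 0"
      using sum_nonneg_eq_0_iff[OF assms(1), of "\<lambda>b. h b * h a"] nn assms(3) by blast
    then show False using assms(4) by simp
  qed
  then show ?thesis using that by blast
qed

text \<open>The kernel equation at \<open>v\<close> has to balance the entry at \<open>e\<close>.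
  This gives both the minimum degree of a circuit's support and the sign arguments for circuit
  moves.\<close>

lemma kernel_opposite_sign:
  assumes "bipartite_graph V E" "pm_A V E *v g = 0" "e \<in> E" "v \<in> e" "g $ e \<noteq> 0"
  obtains f where "f \<in> E" "v \<in> f" "g $ f * g $ e < 0"
proof -
  have "v \<in> V" using simple_graph_edge(2)[OF assms(1,3)] assms(4) by blast
  then have "(\<Sum>e \<in> {e \<in> E. v \<in> e}. g $ e) = 0" using assms(2) unfolding pm_A_kernel_iff by blast
  from sum_eq_0_opposite_sign[OF _ this, of e] show ?thesis using that assms(3-5) by auto
qed

text \<open>Subtracting the multiple of \<open>g\<close> that cancels \<open>y\<close> at one
  coordinate of the support of \<open>g\<close> leaves a kernel vector of strictly smaller support,
  which is zero by minimality.\<close>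

lemma circuit_kernel_multiple:
  assumes g: "is_circuit I A pm_B g"
    and y: "y \<in> coord_space I" "A *v y = 0" "vec_support y \<subseteq> vec_support g"
  obtains s where "y = s *\<^sub>R g"
proof -
  have g': "g \<in> coord_space I" "g \<noteq> 0" "A *v g = 0"
    and min: "\<And>z. z \<in> coord_space I \<Longrightarrow> A *v z = 0 \<Longrightarrow> vec_support z \<subset> vec_support g \<Longrightarrow> z = 0"
    using g unfolding is_circuit_def vec_support_pm_B by blast+
  obtain e where e: "g $ e \<noteq> 0" using g'(2) by (auto simp: vec_eq_iff)
  define s where "s = y $ e / g $ e"
  have "y - s *\<^sub>R g = 0"
  proof (rule min)
    show "y - s *\<^sub>R g \<in> coord_space I" using y g' by (simp add: coord_space_def)
    show "A *v (y - s *\<^sub>R g) = 0"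
      using y g' by (simp add: matrix_vector_mult_diff_distrib matrix_vector_mult_scaleR)
    have "e \<notin> vec_support (y - s *\<^sub>R g)" using e by (simp add: vec_support_def s_def)
    moreover have "e \<in> vec_support g" using e by (simp add: vec_support_def)
    moreover have "vec_support (y - s *\<^sub>R g) \<subseteq> vec_support g"
      using y(3) by (auto simp: vec_support_def)
    ultimately show "vec_support (y - s *\<^sub>R g) \<subset> vec_support g" by blast
  qed
  then show ?thesis using that[of s] by simp
qed

section \<open>Cycles\<close>

lemma nth_mem_cycle_edge_iff:
  assumes "distinct vs" "i < length vs" "j < length vs"
  shows "vs ! i \<in> cycle_edge vs j \<longleftrightarrow> j = i \<or> Suc j mod length vs = i"
proof -
  have "Suc j mod length vs < length vs" using assms(2) by (intro mod_less_divisor) auto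
  then show ?thesis
    using assms by (auto simp: cycle_edge_def nth_eq_iff_index_eq)
qed

text \<open>The cyclic predecessor, with 0 wrapping to \<open>n - 1\<close>. Its uniqueness is what
  limits the cycle edges at a vertex to two.\<close>

lemma Suc_mod_cyclic_pred:
  fixes i n :: nat
  assumes "i < n"
  obtains p where "p < n" "Suc p mod n = i" "\<And>q. q < n \<Longrightarrow> Suc q mod n = i \<Longrightarrow> q = p"
proof
  let ?p = "if i = 0 then n - 1 else i - 1"
  show "?p < n" "Suc ?p mod n = i" using assms by auto
  show "q = ?p" if "q < n" "Suc q mod n = i" for q
    using that assms by (cases "Suc q = n") auto
qed

text \<open>Equal edges at different indices would make each index the cyclic successor of the
  other, which is impossible for length at least three.\<close>

lemma inj_on_cycle_edge:
  assumes "distinct vs" "length vs \<ge> 3"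
  shows "inj_on (cycle_edge vs) {..<length vs}"
proof (rule inj_onI)
  let ?n = "length vs"
  fix i j assume ij: "i \<in> {..<?n}" "j \<in> {..<?n}" "cycle_edge vs i = cycle_edge vs j"
  then have "vs ! i \<in> cycle_edge vs j" "vs ! j \<in> cycle_edge vs i"
    unfolding cycle_edge_def by blast+
  then have "j = i \<or> Suc j mod ?n = i \<and> Suc i mod ?n = j"
    using nth_mem_cycle_edge_iff[OF assms(1)] ij(1,2) by auto
  then show "i = j"
    using ij(1,2) assms(2) by (cases "Suc i = ?n"; cases "Suc j = ?n") auto
qed

text \<open>Take a longest path. A second edge at its first vertex cannot extend it, so it leads
  back to the path and closes a cycle.\<close>

lemma cycle_if_min_degree_two:
  fixes F :: "'v::finite set set"
  assumes ne: "F \<noteq> {}" and c2: "\<And>e. e \<in> F \<Longrightarrow> card e = 2"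
    and deg: "\<And>e v. e \<in> F \<Longrightarrow> v \<in> e \<Longrightarrow> \<exists>f\<in>F. f \<noteq> e \<and> v \<in> f"
  obtains vs C where "cycle_traversal F vs C"
proof -
  \<comment> \<open>Two vertices are required so that there is a first edge to which
    \<open>deg\<close> applies.\<close>
  define path where "path ps \<longleftrightarrow> length ps \<ge> 2 \<and> distinct ps \<and>
    (\<forall>i. Suc i < length ps \<longrightarrow> {ps ! i, ps ! Suc i} \<in> F)" for ps
  obtain e where "e \<in> F" using ne by blast
  moreover from this obtain a b where "e = {a, b}" "a \<noteq> b" using c2 card_2_iff by metis
  ultimately have "path [a, b]" by (simp add: path_def)
  moreover have "\<forall>ps. path ps \<longrightarrow> length ps < Suc (card (UNIV :: 'v set))"
    unfolding path_def by (metis card_mono distinct_card finite le_imp_less_Suc subset_UNIV)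
  ultimately obtain ps where ps: "path ps" and max: "\<And>qs. path qs \<Longrightarrow> length qs \<le> length ps"
    using ex_has_greatest_nat[of path "[a, b]" length] by blast
  obtain u w rest where psu: "ps = u # w # rest"
    using ps unfolding path_def by (metis One_nat_def Suc_1 Suc_le_length_iff)
  have "{u, w} \<in> F" using ps psu unfolding path_def by fastforce
  then obtain f where f: "f \<in> F" "f \<noteq> {u, w}" "u \<in> f" using deg by blast
  then obtain z where z: "f = {u, z}" "z \<noteq> u" "z \<noteq> w"
    using c2[OF f(1)] by (auto simp: card_2_iff)
  have "z \<in> set ps"
  proof (rule ccontr)
    assume "z \<notin> set ps"
    moreover have "{(z # ps) ! i, (z # ps) ! Suc i} \<in> F" if "Suc i < length (z # ps)" for i
      using that ps f(1) z(1) psu unfolding path_def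
      by (cases i) (auto simp: insert_commute)
    ultimately have "path (z # ps)" using ps unfolding path_def by auto
    then show False using max by fastforce
  qed
  then obtain k where k: "k < length ps" "ps ! k = z" by (metis in_set_conv_nth)
  \<comment> \<open>\<open>z\<close> is neither the first nor the second vertex, so the prefix of
    the path ending in \<open>z\<close> has at least three vertices; \<open>f\<close> closes
    it.\<close>
  have k2: "k \<ge> 2" using k z psu by (cases k; cases "k - 1") auto
  define vs where "vs = take (Suc k) ps"
  have len: "length vs = Suc k" using k unfolding vs_def by simp
  have "cycle_edge vs i \<in> F" if "i < length vs" for i
  proof (cases "i = k")
    case True
    moreover have "vs ! k = z" "vs ! 0 = u"
      using k psu unfolding vs_def by (simp_all only: nth_take) auto
    ultimately have "cycle_edge vs i = {z, u}" using len unfolding cycle_edge_def by simp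
    then show ?thesis using f(1) z(1) by (simp add: insert_commute)
  next
    case False
    then have "cycle_edge vs i = {ps ! i, ps ! Suc i}"
      using that len unfolding cycle_edge_def vs_def by simp
    then show ?thesis using ps that False len k(1) unfolding path_def by simp
  qed
  then have "cycle_traversal F vs (cycle_edge vs ` {..<length vs})"
    using k2 len ps unfolding cycle_traversal_def path_def vs_def by auto
  then show ?thesis using that by blast
qed

text \<open>The edge of index \<open>i\<close> leaves the vertex, and the one whose index is the
  cyclic predecessor \<open>p\<close> enters it; distinctness of the vertices excludes all
  others.\<close>

lemma cycle_edges_at_vertex:
  assumes "cycle_traversal E vs C" "i < length vs"
  obtains p where "p < length vs" "Suc p mod length vs = i"
    "{e \<in> C. vs ! i \<in> e} = {cycle_edge vs p, cycle_edge vs i}"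
proof -
  have d: "distinct vs" "C = cycle_edge vs ` {..<length vs}"
    using assms(1) unfolding cycle_traversal_def by auto
  obtain p where p: "p < length vs" "Suc p mod length vs = i"
    "\<And>q. q < length vs \<Longrightarrow> Suc q mod length vs = i \<Longrightarrow> q = p"
    using Suc_mod_cyclic_pred[OF assms(2)] by blast
  have "{e \<in> C. vs ! i \<in> e} = {cycle_edge vs p, cycle_edge vs i}"
  proof -
    have "vs ! i \<in> cycle_edge vs q \<longleftrightarrow> q = i \<or> q = p" if "q < length vs" for q
      using nth_mem_cycle_edge_iff[OF d(1) assms(2) that] p that by metis
    then show ?thesis using p(1) assms(2) unfolding d(2) by blast
  qed
  with p show ?thesis using that by blast
qed

section \<open>Parity and alternating decompositions of cycles\<close>

lemma bipartite_cycle_even: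
  assumes "bipartite_graph V E" "cycle_traversal E vs C"
  shows "even (length vs)"
proof -
  let ?n = "length vs"
  obtain X Y where XY: "X \<inter> Y = {}" "\<forall>e \<in> E. \<exists>x \<in> X. \<exists>y \<in> Y. e = {x, y}"
    using assms(1) unfolding bipartite_graph_def by blast
  have n: "?n \<ge> 3" and CE: "\<And>i. i < ?n \<Longrightarrow> cycle_edge vs i \<in> E"
    using assms(2) unfolding cycle_traversal_def by auto
  have step: "vs ! (Suc i mod ?n) \<in> X \<longleftrightarrow> vs ! i \<notin> X" if i: "i < ?n" for i
  proof -
    obtain x y where "x \<in> X" "y \<in> Y" "cycle_edge vs i = {x, y}" using XY(2) CE[OF i] by metis
    then show ?thesis using XY(1) unfolding cycle_edge_def doubleton_eq_iff by blast
  qed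
  \<comment> \<open>Away from the wrap-around, the parity of the index decides the side. The closing
    edge from the last index \<open>m\<close> to 0 then forces \<open>m\<close> to be odd.\<close>
  have parity: "vs ! i \<in> X \<longleftrightarrow> (even i \<longleftrightarrow> vs ! 0 \<in> X)" if "i < ?n" for i
    using that
  proof (induction i)
    case (Suc i)
    then show ?case using step[of i] by auto
  qed simp
  obtain m where m: "?n = Suc m" using n by (cases ?n) auto
  have "vs ! m \<in> X \<longleftrightarrow> (even m \<longleftrightarrow> vs ! 0 \<in> X)" by (rule parity) (simp add: m)
  moreover have "vs ! 0 \<in> X \<longleftrightarrow> vs ! m \<notin> X" using step[of m] unfolding m by simp
  ultimately have "odd m" by blast
  then show ?thesis using m by simp
qed

text \<open>The edges are split by the parity of their indices. Since the length is even, the parity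
  also alternates across the wrap-around.\<close>

lemma bipartite_cycle_decomposition:
  assumes G: "bipartite_graph V E" and C: "cycle_traversal E vs C"
  obtains Cp Cm where "even_cycle_decomposition E C Cp Cm"
proof -
  let ?n = "length vs"
  have n: "?n \<ge> 3" and d: "distinct vs" and CI: "C = cycle_edge vs ` {..<?n}" and CE: "C \<subseteq> E"
    using C unfolding cycle_traversal_def by auto
  have ev: "even ?n" by (rule bipartite_cycle_even[OF G C])
  have inj: "inj_on (cycle_edge vs) {..<?n}" by (rule inj_on_cycle_edge[OF d n])
  have inj': "cycle_edge vs i = cycle_edge vs j \<longleftrightarrow> i = j" if "i < ?n" "j < ?n" for i j
    using inj_on_eq_iff[OF inj] that by simp
  have parity: "even (Suc i mod ?n) \<longleftrightarrow> odd i" if "i < ?n" for i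
  proof (cases "Suc i = ?n")
    case True
    then have "odd i" using ev by (metis even_Suc)
    then show ?thesis using True by simp
  qed (use that in simp)
  define part where "part b = cycle_edge vs ` {i. i < ?n \<and> even i = b}" for b
  have mem: "cycle_edge vs i \<in> part b \<longleftrightarrow> even i = b" if "i < ?n" for i b
    using that inj' unfolding part_def by auto
  \<comment> \<open>Distinct edges that share a vertex have cyclically consecutive indices, hence
    indices of different parity.\<close>
  have disj: "disjnt (cycle_edge vs i) (cycle_edge vs j)"
    if ij: "i < ?n" "j < ?n" "even i = even j" "i \<noteq> j" for i j
  proof (rule ccontr)
    assume "\<not> ?thesis"
    then have "vs ! i \<in> cycle_edge vs j \<or> vs ! (Suc i mod ?n) \<in> cycle_edge vs j"
      unfolding disjnt_def cycle_edge_def[of vs i] by blast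
    moreover have "Suc i mod ?n < ?n" using ij(1) by (intro mod_less_divisor) auto
    ultimately have "Suc j mod ?n = i \<or> j = Suc i mod ?n \<or> Suc j mod ?n = Suc i mod ?n"
      using nth_mem_cycle_edge_iff[OF d _ ij(2)] ij by auto
    then show False
      using parity[OF ij(1)] parity[OF ij(2)] ij
      by (cases "Suc i = ?n"; cases "Suc j = ?n") auto
  qed
  have match: "matching E (part b)" for b
    unfolding matching_def
  proof
    show "part b \<subseteq> E" using CE unfolding CI part_def by auto
    show "pairwise disjnt (part b)"
      using disj unfolding part_def by (auto intro!: pairwiseI)
  qed
  have "even_cycle_decomposition E C (part True) (part False)"
    unfolding even_cycle_decomposition_def
  proof (intro conjI exI[of _ vs] match C allI impI)
    show "even (card C)" using ev card_image[OF inj] unfolding CI by simp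
    show "part True \<union> part False = C" unfolding part_def CI by auto
    show "part True \<inter> part False = {}" using mem unfolding part_def by auto
    show "cycle_edge vs i \<in> part True \<longleftrightarrow> cycle_edge vs (Suc i mod ?n) \<in> part False" if "i < ?n" for i
    proof -
      have "Suc i mod ?n < ?n" using that by (intro mod_less_divisor) auto
      then show ?thesis using mem that parity by auto
    qed
  qed
  then show ?thesis using that by blast
qed

text \<open>Each cycle edge lies in exactly one part, so negating both sides of the alternation
  condition exchanges the parts. This serves to absorb a negative coefficient.\<close>

lemma even_cycle_decomposition_swap:
  assumes "even_cycle_decomposition E C Cp Cm"
  shows "even_cycle_decomposition E C Cm Cp"
proof -
  obtain vs where vs: "cycle_traversal E vs C"
    "\<And>i. i < length vs \<Longrightarrow> cycle_edge vs i \<in> Cp \<longleftrightarrow> cycle_edge vs (Suc i mod length vs) \<in> Cm"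
    and D: "Cp \<union> Cm = C" "Cp \<inter> Cm = {}"
    using assms unfolding even_cycle_decomposition_def by blast
  have in_C: "cycle_edge vs i \<in> C" if "i < length vs" for i
    using vs(1) that unfolding cycle_traversal_def by auto
  have "cycle_edge vs i \<in> Cm \<longleftrightarrow> cycle_edge vs (Suc i mod length vs) \<in> Cp" if "i < length vs" for i
  proof -
    have "Suc i mod length vs < length vs" using that by (intro mod_less_divisor) auto
    then show ?thesis using vs(2)[OF that] in_C that D by blast
  qed
  then show ?thesis using assms vs(1) unfolding even_cycle_decomposition_def by blast
qed

section \<open>Kernel vectors supported on a cycle\<close>

lemma kernel_on_cycle_alternates:
  assumes G: "bipartite_graph V E" and C: "cycle_traversal E vs C"
    and y: "pm_A V E *v y = 0" "vec_support y \<subseteq> C" and p: "p < length vs"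
  shows "y $ cycle_edge vs (Suc p mod length vs) = - y $ cycle_edge vs p"
proof -
  let ?i = "Suc p mod length vs"
  have i: "?i < length vs" using p by (intro mod_less_divisor) auto
  obtain q where q: "q < length vs" "Suc q mod length vs = ?i"
    "{e \<in> C. vs ! ?i \<in> e} = {cycle_edge vs q, cycle_edge vs ?i}"
    using cycle_edges_at_vertex[OF C i] by blast
  have "p = q" using Suc_mod_cyclic_pred[OF i] p q(1,2) by metis
  note q = q(3)[folded this]
  have CE: "C \<subseteq> E" and n: "length vs \<ge> 3" and d: "distinct vs"
    and iC: "cycle_edge vs ?i \<in> C" using C i unfolding cycle_traversal_def by auto
  have "vs ! ?i \<in> cycle_edge vs ?i" by (simp add: cycle_edge_def)
  then have "vs ! ?i \<in> V" using simple_graph_edge(2)[OF G, of "cycle_edge vs ?i"] iC CE by blast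
  \<comment> \<open>\<open>y\<close> vanishes outside \<open>C\<close>, so the kernel equation at
    the shared vertex retains only the two consecutive cycle edges.\<close>
  then have "0 = (\<Sum>e \<in> {e \<in> E. vs ! ?i \<in> e}. y $ e)" using y(1) unfolding pm_A_kernel_iff by simp
  also have "\<dots> = (\<Sum>e \<in> {e \<in> C. vs ! ?i \<in> e}. y $ e)"
    using CE y(2) by (intro sum.mono_neutral_right) (auto simp: vec_support_def)
  also have "\<dots> = y $ cycle_edge vs p + y $ cycle_edge vs ?i"
  proof -
    have "p \<noteq> ?i" using n p by (cases "Suc p = length vs") auto
    then have "cycle_edge vs p \<noteq> cycle_edge vs ?i"
      using inj_onD[OF inj_on_cycle_edge[OF d n]] p i by blast
    then show ?thesis unfolding q by simp
  qed
  finally show ?thesis by simp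
qed

text \<open>Strict inclusion provides one zero entry on the cycle, and alternation carries it all
  the way around.\<close>

lemma kernel_on_cycle_eq_0:
  assumes G: "bipartite_graph V E" and C: "cycle_traversal E vs C"
    and y: "pm_A V E *v y = 0" "vec_support y \<subset> C"
  shows "y = 0"
proof -
  let ?n = "length vs"
  have CI: "C = cycle_edge vs ` {..<?n}" and n: "?n \<ge> 3"
    using C unfolding cycle_traversal_def by auto
  obtain k where k: "k < ?n" "y $ cycle_edge vs k = 0"
    using y(2) unfolding CI vec_support_def by blast
  have *: "y $ cycle_edge vs ((k + j) mod ?n) = 0" for j
  proof (induction j)
    case 0
    then show ?case using k by simp
  next
    case (Suc j)
    have "(k + j) mod ?n < ?n" using n by (intro mod_less_divisor) auto
    from kernel_on_cycle_alternates[OF G C y(1) _ this] Suc y(2)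
    show ?case by (auto simp: mod_Suc_eq)
  qed
  \<comment> \<open>The offset \<open>?n - k + i\<close> leads from index \<open>k\<close> to index
    \<open>i\<close> modulo \<open>?n\<close>.\<close>
  have "y $ cycle_edge vs i = 0" if "i < ?n" for i
    using *[of "?n - k + i"] k(1) that by simp
  then have "y $ e = 0" for e
    using y(2) unfolding CI vec_support_def by blast
  then show ?thesis by (simp add: vec_eq_iff)
qed

section \<open>Alternating cycle vectors as circuits\<close>

lemma vec_support_cycle_vector:
  assumes "\<alpha> \<noteq> 0"
  shows "vec_support (cycle_vector Cp Cm \<alpha>) = Cp \<union> Cm"
  using assms by (auto simp: vec_support_def cycle_vector_def)

text \<open>A vertex on the cycle meets exactly two cycle edges, one from each matching, whose
  entries cancel; any other vertex meets none.\<close>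

lemma cycle_vector_kernel:
  assumes "even_cycle_decomposition E C Cp Cm"
  shows "pm_A V E *v cycle_vector Cp Cm \<alpha> = 0"
  unfolding pm_A_kernel_iff
proof
  fix v assume "v \<in> V"
  let ?g = "cycle_vector Cp Cm \<alpha>"
  obtain vs where vs: "cycle_traversal E vs C"
    "\<And>i. i < length vs \<Longrightarrow> cycle_edge vs i \<in> Cp \<longleftrightarrow> cycle_edge vs (Suc i mod length vs) \<in> Cm"
    and D: "Cp \<union> Cm = C" "Cp \<inter> Cm = {}"
    using assms unfolding even_cycle_decomposition_def by blast
  have CE: "C \<subseteq> E" and n: "length vs \<ge> 3" and CI: "C = cycle_edge vs ` {..<length vs}"
    using vs(1) unfolding cycle_traversal_def by auto
  have "(\<Sum>e \<in> {e \<in> E. v \<in> e}. ?g $ e) = (\<Sum>e \<in> {e \<in> C. v \<in> e}. ?g $ e)"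
    using CE D by (intro sum.mono_neutral_right) (auto simp: cycle_vector_def)
  also have "\<dots> = 0"
  proof (cases "v \<in> set vs")
    case True
    then obtain i where i: "i < length vs" "v = vs ! i" by (metis in_set_conv_nth)
    obtain p where p: "p < length vs" "Suc p mod length vs = i"
      "{e \<in> C. vs ! i \<in> e} = {cycle_edge vs p, cycle_edge vs i}"
      using cycle_edges_at_vertex[OF vs(1) i(1)] by blast
    have alt: "cycle_edge vs p \<in> Cp \<longleftrightarrow> cycle_edge vs i \<in> Cm" using vs(2)[OF p(1)] p(2) by simp
    have mem: "cycle_edge vs p \<in> Cp \<union> Cm" "cycle_edge vs i \<in> Cp \<union> Cm" using D(1) CI p(1) i(1) by auto
    have "cycle_edge vs p \<noteq> cycle_edge vs i" using alt mem D(2) by auto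
    then show ?thesis
      unfolding i(2) p(3) using alt mem D(2) by (auto simp: cycle_vector_def)
  next
    case False
    have "{e \<in> C. v \<in> e} = {}"
    proof -
      have "v \<notin> cycle_edge vs i" if "i < length vs" for i
      proof -
        have "Suc i mod length vs < length vs" using that by (intro mod_less_divisor) auto
        then show ?thesis using False that nth_mem by (auto simp: cycle_edge_def)
      qed
      then show ?thesis unfolding CI by auto
    qed
    then show ?thesis by (simp only: sum.empty)
  qed
  finally show "(\<Sum>e \<in> {e \<in> E. v \<in> e}. ?g $ e) = 0" .
qed

lemma cycle_vector_in_coord_space:
  assumes "even_cycle_decomposition E C Cp Cm"
  shows "cycle_vector Cp Cm \<alpha> \<in> coord_space E"
  using assms
  unfolding even_cycle_decomposition_def matching_def coord_space_def cycle_vector_def by auto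

text \<open>The support is the whole cycle, so minimality is the vanishing of kernel vectors
  supported on a proper part of it.\<close>

lemma cycle_vector_is_circuit:
  assumes G: "bipartite_graph V E" and D: "even_cycle_decomposition E C Cp Cm" and "\<alpha> \<noteq> 0"
  shows "is_circuit E (pm_A V E) pm_B (cycle_vector Cp Cm \<alpha>)"
proof -
  obtain vs where vs: "cycle_traversal E vs C" and C: "Cp \<union> Cm = C"
    using D unfolding even_cycle_decomposition_def by blast
  have "cycle_edge vs 0 \<in> C" using vs unfolding cycle_traversal_def by force
  then have "C \<noteq> {}" by blast
  then have "vec_support (cycle_vector Cp Cm \<alpha>) \<noteq> {}"
    unfolding vec_support_cycle_vector[OF assms(3)] C .
  then have "cycle_vector Cp Cm \<alpha> \<noteq> 0" by (auto simp: vec_support_def)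
  then show ?thesis
    unfolding is_circuit_def vec_support_pm_B vec_support_cycle_vector[OF assms(3)] C
    using cycle_vector_in_coord_space[OF D] cycle_vector_kernel[OF D] kernel_on_cycle_eq_0[OF G vs]
    by blast
qed

lemma circuit_is_cycle_vector:
  assumes G: "bipartite_graph V E" and g: "is_circuit E (pm_A V E) pm_B g"
  obtains C Cp Cm \<alpha> where "even_cycle_decomposition E C Cp Cm" "\<alpha> > 0" "g = cycle_vector Cp Cm \<alpha>"
proof -
  have g': "g \<in> coord_space E" "g \<noteq> 0" "pm_A V E *v g = 0"
    using g unfolding is_circuit_def by blast+
  let ?F = "vec_support g"
  have FE: "?F \<subseteq> E" using g'(1) unfolding coord_space_def vec_support_def by blast
  obtain vs C where C: "cycle_traversal ?F vs C"
  proof (rule cycle_if_min_degree_two[of ?F])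
    show "?F \<noteq> {}" using g'(2) by (auto simp: vec_support_def vec_eq_iff)
    show "card e = 2" if "e \<in> ?F" for e using simple_graph_edge(1)[OF G] FE that by blast
    show "\<exists>f\<in>?F. f \<noteq> e \<and> v \<in> f" if "e \<in> ?F" "v \<in> e" for e v
    proof -
      have "e \<in> E" "g $ e \<noteq> 0" using that FE by (auto simp: vec_support_def)
      from kernel_opposite_sign[OF G g'(3) this(1) that(2) this(2)]
      obtain f where "f \<in> E" "v \<in> f" "g $ f * g $ e < 0" .
      then show ?thesis by (intro bexI[of _ f]) (auto simp: vec_support_def mult_less_0_iff)
    qed
  qed
  have CF: "C \<subseteq> ?F" and CE: "cycle_traversal E vs C"
    using C FE unfolding cycle_traversal_def by auto
  obtain Cp Cm where D: "even_cycle_decomposition E C Cp Cm"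
    using bipartite_cycle_decomposition[OF G CE] by blast
  have U: "Cp \<union> Cm = C" "Cp \<inter> Cm = {}" using D unfolding even_cycle_decomposition_def by auto
  let ?y = "cycle_vector Cp Cm 1"
  have "vec_support ?y \<subseteq> vec_support g"
    using vec_support_cycle_vector[of 1 Cp Cm] U(1) CF by simp
  then obtain s where s: "?y = s *\<^sub>R g"
    using circuit_kernel_multiple[OF g cycle_vector_in_coord_space[OF D] cycle_vector_kernel[OF D]]
    by blast
  have "?y \<noteq> 0"
    using cycle_vector_is_circuit[OF G D, of 1] unfolding is_circuit_def by simp
  then have s0: "s \<noteq> 0" using s by auto
  then have gy: "g = (1 / s) *\<^sub>R ?y" using s by simp
  show ?thesis
  proof (cases "s > 0")
    case True
    then have "g = cycle_vector Cp Cm (1 / s)"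
      unfolding gy by (auto simp: vec_eq_iff cycle_vector_def)
    then show ?thesis using that[OF D, of "1 / s"] True by simp
  next
    \<comment> \<open>Here \<open>s\<close> is negative; exchanging the two matchings flips the sign
      and makes the coefficient positive.\<close>
    case False
    then have "g = cycle_vector Cm Cp (- 1 / s)"
      unfolding gy using U(2) by (auto simp: vec_eq_iff cycle_vector_def)
    then show ?thesis using that[OF even_cycle_decomposition_swap[OF D], of "- 1 / s"] False s0 by simp
  qed
qed

section \<open>Circuit moves\<close>

text \<open>A combination of two nonnegative numbers with positive weights is zero only if both
  numbers are.\<close>

lemma face_of_zero_coordinates:
  fixes P :: "(real ^ 'n) set"
  assumes "convex P" "\<And>x i. x \<in> P \<Longrightarrow> x $ i \<ge> 0"
  shows "{x \<in> P. \<forall>i\<in>S. x $ i = 0} face_of P"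
  unfolding face_of_def
proof (intro conjI ballI impI)
  show "convex {x \<in> P. \<forall>i\<in>S. x $ i = 0}"
    using assms(1) unfolding convex_def by auto
  fix a b x assume ab: "a \<in> P" "b \<in> P" "x \<in> {x \<in> P. \<forall>i\<in>S. x $ i = 0}" "x \<in> open_segment a b"
  then obtain u where u: "0 < u" "u < 1" "x = (1 - u) *\<^sub>R a + u *\<^sub>R b"
    unfolding in_segment by blast
  have "a $ i = 0 \<and> b $ i = 0" if "i \<in> S" for i
  proof -
    have "(1 - u) * a $ i + u * b $ i = 0" using ab(3) that u(3) by auto
    moreover have "(1 - u) * a $ i \<ge> 0" "u * b $ i \<ge> 0" using u assms(2) ab by auto
    ultimately have "(1 - u) * a $ i = 0" "u * b $ i = 0" by linarith+
    then show ?thesis using u by auto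
  qed
  then show "a \<in> {x \<in> P. \<forall>i\<in>S. x $ i = 0}" "b \<in> {x \<in> P. \<forall>i\<in>S. x $ i = 0}" using ab by auto
qed auto

text \<open>A nondegenerate segment has dimension one, and extreme points of a face are extreme in
  the whole set.\<close>

lemma skeleton_adjacent_if_segment_face:
  assumes "closed_segment x y face_of P" "x \<noteq> y"
  shows "skeleton_adjacent P x y"
proof -
  have "aff_dim (closed_segment x y) = 1"
    using assms(2) by (simp add: segment_convex_hull aff_dim_convex_hull)
  then show ?thesis
    using assms extreme_point_of_face[OF assms(1), of x] extreme_point_of_face[OF assms(1), of y]
    by (simp add: skeleton_adjacent_def edge_of_def extreme_point_of_segment)
qed

lemma circuit_move_adjacent:
  assumes G: "bipartite_graph V E"
    and x: "x extreme_point_of perfect_matching_polytope V E"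
    and move: "circuit_move E (pm_A V E) (pm_b V) pm_B pm_d c x x'" and "x' \<noteq> x"
  shows "skeleton_adjacent (perfect_matching_polytope V E) x x'"
proof -
  let ?P = "polyhedron_of E (pm_A V E) (pm_b V) pm_B pm_d"
  have P: "perfect_matching_polytope V E = ?P" by (rule perfect_matching_polytope_eq_polyhedron[OF G])
  have cvx: "convex ?P" unfolding P[symmetric] perfect_matching_polytope_def by simp
  have nn: "z $ e \<ge> 0" if "z \<in> ?P" for z e
    using that unfolding mem_pm_polyhedron by (cases "e \<in> E") auto
  obtain g t where g: "is_circuit E (pm_A V E) pm_B g" and t: "t \<ge> 0" "x' = x + t *\<^sub>R g" "x' \<in> ?P"
    and tmax: "\<And>s. s \<ge> 0 \<Longrightarrow> x + s *\<^sub>R g \<in> ?P \<Longrightarrow> s \<le> t" and xP: "x \<in> ?P"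
    using move unfolding circuit_move_def by blast
  have tpos: "t > 0" using t assms(4) by (cases "t = 0") auto
  have g': "g \<in> coord_space E" "g \<noteq> 0" "pm_A V E *v g = 0"
    using g unfolding is_circuit_def by blast+
  have gE: "e \<in> E" if "g $ e \<noteq> 0" for e using g'(1) that unfolding coord_space_def by blast
  obtain M where M: "perfect_matching V E M" "x = incidence_vector M"
    using extreme_point_of_convex_hull x unfolding perfect_matching_polytope_def by blast
  have xv: "x $ e = (if e \<in> M then 1 else 0)" for e by (simp add: M(2) incidence_vector_def)
  have uniq: "e = f" if "e \<in> M" "f \<in> M" "v \<in> e" "v \<in> f" for e f v
    using M(1) that unfolding perfect_matching_def matching_def pairwise_def disjnt_def by blast
  \<comment> \<open>Outside \<open>M\<close> the point \<open>x\<close> is zero, so a negative entry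
    of \<open>g\<close> there would make \<open>x'\<close> negative.\<close>
  have neg: "e \<in> M" if "g $ e < 0" for e
  proof (rule ccontr)
    assume "e \<notin> M"
    then have "x' $ e = t * g $ e" using t(2) xv by simp
    moreover have "t * g $ e < 0" using tpos that by (simp add: mult_pos_neg)
    ultimately show False using nn[OF t(3), of e] by simp
  qed
  have ne: "\<exists>v. v \<in> e" if "e \<in> E" for e using simple_graph_edge(1)[OF G that] by (auto simp: card_2_iff)
  have partner: "\<exists>f\<in>E. v \<in> f \<and> g $ f * g $ e < 0" if "g $ e \<noteq> 0" "v \<in> e" for e v
    using kernel_opposite_sign[OF G g'(3) gE[OF that(1)] that(2,1)] by blast
  \<comment> \<open>At a vertex of the support both signs of \<open>g\<close> occur. The negative
    edge is in \<open>M\<close>, which has one edge per vertex, so the positive edge is not. This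
    edge will exclude moving backwards along \<open>g\<close>.\<close>
  obtain e0 where e0: "g $ e0 > 0" "x $ e0 = 0"
  proof -
    obtain e where e: "g $ e \<noteq> 0" using g'(2) by (auto simp: vec_eq_iff)
    obtain v where v: "v \<in> e" using ne gE[OF e] by blast
    obtain f where f: "v \<in> f" "g $ f * g $ e < 0" using partner[OF e v] by blast
    obtain p q where "g $ p > 0" "g $ q < 0" "v \<in> p" "v \<in> q"
      using f v by (cases "g $ e > 0") (auto simp: mult_less_0_iff)
    moreover from this have "p \<notin> M" using neg[of q] uniq[of p q v] by auto
    ultimately show ?thesis using that xv by simp
  qed
  define F where "F = {z \<in> ?P. \<forall>e\<in>{e. x $ e = 0 \<and> x' $ e = 0}. z $ e = 0}"
  have face: "F face_of ?P" unfolding F_def by (rule face_of_zero_coordinates[OF cvx nn])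
  have "F = closed_segment x x'"
  proof
    have "x \<in> F" "x' \<in> F" using xP t(3) unfolding F_def by auto
    then show "closed_segment x x' \<subseteq> F"
      using closed_segment_subset face_of_imp_convex[OF face] by blast
    show "F \<subseteq> closed_segment x x'"
    proof
      fix z assume z: "z \<in> F"
      have zP: "z \<in> ?P" using z unfolding F_def by blast
      have "z - x \<in> coord_space E" using zP xP unfolding mem_pm_polyhedron coord_space_def by simp
      moreover have "pm_A V E *v (z - x) = 0"
        using zP xP unfolding polyhedron_of_def by (simp add: matrix_vector_mult_diff_distrib)
      moreover have "vec_support (z - x) \<subseteq> vec_support g"
      proof (rule subsetI, rule ccontr)
        fix e assume e: "e \<in> vec_support (z - x)" "e \<notin> vec_support g"
        then have ge: "g $ e = 0" by (simp add: vec_support_def)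
        have zx: "z $ e \<noteq> x $ e" using e(1) by (simp add: vec_support_def)
        \<comment> \<open>Off \<open>M\<close> and off the support of \<open>g\<close>, both
          \<open>x\<close> and \<open>x'\<close> vanish, hence so does \<open>z\<close>.\<close>
        have eM: "e \<in> M"
        proof (rule ccontr)
          assume "e \<notin> M"
          then show False using z zx ge xv t(2) unfolding F_def by auto
        qed
        then have eE: "e \<in> E" using M(1) unfolding perfect_matching_def matching_def by blast
        then obtain v where v: "v \<in> e" using ne by blast
        \<comment> \<open>A nonzero entry at \<open>v\<close> would come with a negative one; its
          edge lies in \<open>M\<close>, hence is \<open>e\<close>, where \<open>g\<close> is
          zero.\<close>
        have g0: "g $ f = 0" if "v \<in> f" for f
        proof (rule ccontr)
          assume f: "g $ f \<noteq> 0"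
          obtain h where "v \<in> h" "g $ h * g $ f < 0" using partner[OF f \<open>v \<in> f\<close>] by blast
          then obtain q where "v \<in> q" "g $ q < 0" using \<open>v \<in> f\<close> by (auto simp: mult_less_0_iff)
          then show False using neg[of q] uniq[of q e v] eM v ge by auto
        qed
        \<comment> \<open>The other edges at \<open>v\<close> are thus zero in \<open>x\<close> and
          \<open>x'\<close>, so also in \<open>z\<close>, and the equation at \<open>v\<close>
          forces \<open>z\<close> to be 1 at \<open>e\<close>, as \<open>x\<close> is.\<close>
        have z0: "z $ f = 0" if "v \<in> f" "f \<noteq> e" for f
        proof -
          have "f \<notin> M" using uniq[of f e v] eM v that by blast
          then show ?thesis using z g0[OF that(1)] xv t(2) unfolding F_def by auto
        qed
        have "v \<in> V" using simple_graph_edge(2)[OF G eE] v by blast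
        then have "1 = (\<Sum>f \<in> {f \<in> E. v \<in> f}. z $ f)" using zP unfolding mem_pm_polyhedron by simp
        also have "\<dots> = (\<Sum>f \<in> {e}. z $ f)"
          using eE v z0 by (intro sum.mono_neutral_right) auto
        finally show False using zx xv eM by simp
      qed
      ultimately obtain s where "z - x = s *\<^sub>R g" using circuit_kernel_multiple[OF g] by blast
      then have zs: "z = x + s *\<^sub>R g" by (simp add: algebra_simps)
      \<comment> \<open>Nonnegativity at \<open>e0\<close> bounds \<open>s\<close> from below, and
        maximality of the step length \<open>t\<close> bounds it from above.\<close>
      have "s * g $ e0 \<ge> 0" using nn[OF zP, of e0] e0(2) zs by simp
      then have s0: "s \<ge> 0" using e0(1) by (simp add: zero_le_mult_iff)
      then have st: "s \<le> t" using tmax zP zs by blast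
      have "z = (1 - s / t) *\<^sub>R x + (s / t) *\<^sub>R x'"
        unfolding zs t(2) using tpos by (simp add: algebra_simps)
      then show "z \<in> closed_segment x x'"
        unfolding in_segment using s0 st tpos by (intro exI[of _ "s / t"]) auto
    qed
  qed
  then show ?thesis
    using skeleton_adjacent_if_segment_face face assms(4) unfolding P by metis
qed

theorem lemma2:
  fixes V :: "'v::finite set" and E :: "'v set set"
  assumes "bipartite_graph V E"
  shows "(\<forall>g \<in> coord_space E. g \<noteq> 0 \<longrightarrow>
            (is_circuit E (pm_A V E) pm_B g \<longleftrightarrow>
              (\<exists>C Cp Cm \<alpha>. even_cycle_decomposition E C Cp Cm \<and> \<alpha> > 0 \<and> g = cycle_vector Cp Cm \<alpha>)))
       \<and> (\<forall>c \<in> coord_space E. \<forall>x x'.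
            x extreme_point_of perfect_matching_polytope V E \<longrightarrow>
            circuit_move E (pm_A V E) (pm_b V) pm_B pm_d c x x' \<longrightarrow>
            x' \<noteq> x \<longrightarrow>
              x' extreme_point_of perfect_matching_polytope V E \<and>
              skeleton_adjacent (perfect_matching_polytope V E) x x')"
proof (intro conjI ballI allI impI)
  fix g :: "real ^ 'v set"
  show "is_circuit E (pm_A V E) pm_B g \<longleftrightarrow>
      (\<exists>C Cp Cm \<alpha>. even_cycle_decomposition E C Cp Cm \<and> \<alpha> > 0 \<and> g = cycle_vector Cp Cm \<alpha>)"
  proof
    assume "is_circuit E (pm_A V E) pm_B g"
    then show "\<exists>C Cp Cm \<alpha>. even_cycle_decomposition E C Cp Cm \<and> \<alpha> > 0 \<and> g = cycle_vector Cp Cm \<alpha>"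
      using circuit_is_cycle_vector[OF assms] by blast
  next
    assume "\<exists>C Cp Cm \<alpha>. even_cycle_decomposition E C Cp Cm \<and> \<alpha> > 0 \<and> g = cycle_vector Cp Cm \<alpha>"
    then show "is_circuit E (pm_A V E) pm_B g"
      using cycle_vector_is_circuit[OF assms] by force
  qed
next
  fix c x x' :: "real ^ 'v set"
  assume "x extreme_point_of perfect_matching_polytope V E"
    "circuit_move E (pm_A V E) (pm_b V) pm_B pm_d c x x'" "x' \<noteq> x"
  then show adj: "skeleton_adjacent (perfect_matching_polytope V E) x x'"
    by (rule circuit_move_adjacent[OF assms])
  then show "x' extreme_point_of perfect_matching_polytope V E"
    unfolding skeleton_adjacent_def by blast
qed

end
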